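(* Let $n \in \mathbb{N}_0$ and let $z \in \mathbb{C}$ with $0 < \operatorname{Re}(z) < 1$ and $\operatorname{Re}(2n + 2z) > 1$. Then $$\zeta(2n + 2z) = \frac{(-1)^n \pi^{2(n+z)}}{\Gamma(1-z)\Gamma(n+z)} \int_0^{\infty} t^{-z}\, \frac{d^n}{dt^n} \Big[(2 t)^{-1} \big[t^{1/2} \coth\big(t^{1/2}\big) - 1\big]\Big]\, dt$$ $$= \frac{(-1)^n 2^{-n} \pi^{2(n+z)}}{\Gamma(1-z)\Gamma(n+z)} \int_0^{\infty} s^{1 - 2z} \Big(\frac{1}{s}\frac{d}{ds}\Big)^n \Big[s^{-2} [s \coth(s) - 1]\Big]\, ds .$$ Moreover, one obtains $$\zeta(5) = \frac{\pi^4}{3} \int_0^{\infty} s^{-6} \Big[2 s^3 \coth(s) [\sinh(s)]^{-2} + 3 s^2 [\sinh(s)]^{-2} + 3 s \coth(s) - 8\Big]\, ds,$$ $$\zeta(7) = \frac{\pi^6}{15} \int_0^{\infty} s^{-8} \Big[4 s^4 [\coth(s)]^2 [\sinh(s)]^{-2} + 2 s^4 [\sinh(s)]^{-4} + 12 s^3 \coth(s) [\sinh(s)]^{-2} + 15 s^2 [\sinh(s)]^{-2} + 15 s \coth(s) - 48\Big]\, ds.$$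
   Context: $\mathbb{N}_0 = \{0,1,2,\dots\}$. $\zeta$ is the Riemann zeta function, $\zeta(w) = \sum_{k=1}^\infty k^{-w}$ for $\operatorname{Re}(w) > 1$, and $\Gamma$ is the Gamma function. The condition $\operatorname{Re}(2n+2z)>1$ is a restriction only for $n=0$, where it means $1/2 < \operatorname{Re}(z) < 1$. The notation $\big(\frac{1}{s}\frac{d}{ds}\big)^n$ denotes the $n$-fold iterate of the operator $f \mapsto \frac{1}{s} f'(s)$ (the identity for $n=0$). Powers of positive numbers such as $t^{-z}$ are defined by $x^{w} = e^{w \ln x}$ with the real logarithm. *)

theory Defs
  imports "HOL-Analysis.Analysis"
begin

text \<open>
  The Riemann zeta function as a Dirichlet series. The series converges for
  \<open>Re w > 1\<close>, and this constant is meaningful only there; no analytic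
  continuation is involved. Indices are shifted by one.
\<close>

definition zeta :: "complex \<Rightarrow> complex" where
  "zeta w = (\<Sum>k. of_nat (Suc k) powr (- w))"

definition coth :: "real \<Rightarrow> real" where
  "coth x = cosh x / sinh x"

text \<open>
  The operator \<open>(1/s) d/ds\<close>, to be iterated with \<open>^^\<close>. Its value at \<open>s = 0\<close> is irrelevant:
  the iterates at \<open>s > 0\<close> depend only on \<open>f\<close> near \<open>s\<close>.
\<close>

definition radial_deriv :: "(real \<Rightarrow> real) \<Rightarrow> real \<Rightarrow> real" where
  "radial_deriv f = (\<lambda>s. (1 / s) * deriv f s)"

end

theory Submission
  imports Defs
begin

text \<open>
  The poles of \<open>coth\<close> encode the zeta function. In the variable \<open>t = s\<^sup>2\<close> the partial fraction
  expansion of \<open>coth\<close> (\<open>coth_sums\<close>) reads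
    \<open>(sqrt t coth (sqrt t) - 1) / (2 t) = \<Sum>k\<ge>1. 1 / (t + (k pi)\<^sup>2)\<close>,
  and it is derived here from the reflection formula of the Gamma function by logarithmic differentiation.
  For \<open>t > 0\<close> the series may be differentiated termwise any number of times, so that the \<open>n\<close>-th
  derivative is \<open>(-1)^n n!\<close> times the sum of the \<open>1 / (t + (k pi)\<^sup>2)^(n + 1)\<close>.

  Integrating one such fraction against \<open>t powr (-z)\<close> is a Beta integral over the half-line
  (\<open>has_bochner_integral_Beta_Ioi\<close>); its value is
  \<open>Gamma (1 - z) Gamma (n + z) / n!\<close> times \<open>(k pi) powr (-(2 n + 2 z))\<close>. Summing over \<open>k\<close> produces \<open>zeta (2 n + 2 z)\<close>.
  The exchange of sum and integral is justified by absolute convergence: passing to absolute values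
  replaces \<open>z\<close> by \<open>Re z\<close>, and the resulting zeta series converges exactly when \<open>Re (2 n + 2 z) > 1\<close>
  (\<open>has_bochner_integral_pole_sum_deriv\<close>).

  The second representation is the first one after the substitution \<open>t = s\<^sup>2\<close>, under which \<open>d/dt\<close>
  becomes \<open>(1 / (2 s)) d/ds\<close>. Finally, the formulas for \<open>zeta 5\<close> and \<open>zeta 7\<close> are the cases \<open>n = 2\<close> and \<open>n = 3\<close>
  with \<open>z = 1 / 2\<close>, once the iterates of \<open>(1 / s) d/ds\<close> are worked out explicitly.
\<close>

section \<open>Integrals over the positive half-line\<close>

text \<open>
  In the proof every integral over \<open>(0, \<infinity>)\<close> is written as \<open>has_bochner_integral\<close> of a function cut off
  by an indicator: one fact then carries both integrability and the value, and Fubini's theorem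
  and termwise integration apply to it directly.
\<close>

lemma has_bochner_integral_Ioi_iff:
  fixes f :: "real \<Rightarrow> 'a :: {banach, second_countable_topology}"
  shows "has_bochner_integral lborel (\<lambda>t. indicator {0<..} t *\<^sub>R f t) v \<longleftrightarrow>
           set_integrable lborel {0<..} f \<and> (LINT t:{0<..}|lborel. f t) = v"
  by (simp add: has_bochner_integral_iff set_integrable_def set_lebesgue_integral_def)

text \<open>
  The Gamma integral and the change of variables theorem speak of absolute gauge integrability, for which
  Lebesgue measurability is enough; continuity supplies the Borel measurability that \<open>lborel\<close> demands.
\<close>

lemma has_bochner_integral_Ioi_iff_absolutely_integrable:
  fixes f :: "real \<Rightarrow> 'a :: euclidean_space"
  assumes "continuous_on {0<..} f"
  shows "has_bochner_integral lborel (\<lambda>t. indicator {0<..} t *\<^sub>R f t) v \<longleftrightarrow>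
           f absolutely_integrable_on {0<..} \<and> integral {0<..} f = v"
proof -
  have meas: "(\<lambda>t. indicator {0<..} t *\<^sub>R f t) \<in> borel_measurable borel"
    using assms by (intro borel_measurable_continuous_on_indicator) auto
  have eq: "set_integrable lborel {0<..} f \<longleftrightarrow> f absolutely_integrable_on {0<..}"
    using meas by (simp add: set_integrable_def integrable_completion)
  show ?thesis
    unfolding has_bochner_integral_Ioi_iff eq
    using eq set_borel_integral_eq_integral(2) by auto
qed

lemma continuous_on_of_real_powr [continuous_intros]:
  "continuous_on {0<..} (\<lambda>t. complex_of_real t powr w)"
  by (intro continuous_on_powr_complex continuous_intros) (auto simp: complex_nonpos_Reals_iff)

lemma norm_of_real_powr: 
  "t > 0 \<Longrightarrow> norm (complex_of_real t powr w) = t powr Re w"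
  by (simp add: norm_powr_real_powr)

section \<open>The Beta integral over the positive half-line\<close>

text \<open>
  Euler's integral for \<open>Gamma w\<close> after the substitution \<open>t \<mapsto> x t\<close>, which produces the factor \<open>x powr (-w)\<close>.
\<close>

lemma has_bochner_integral_Gamma:
  assumes w: "Re w > 0" and x: "x > 0"
  shows "has_bochner_integral lborel
           (\<lambda>t. indicator {0<..} t *\<^sub>R (of_real t powr (w - 1) * of_real (exp (- (x * t)))))
           (Gamma w * of_real x powr (- w))"
proof -
  let ?f = "\<lambda>t::real. complex_of_real t powr (w - 1) * of_real (exp (- t))"
  have "has_bochner_integral lborel (\<lambda>t. indicator {0<..} t *\<^sub>R ?f t) (Gamma w)"
  proof (subst has_bochner_integral_Ioi_iff_absolutely_integrable)
    show "continuous_on {0<..} ?f"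
      by (intro continuous_intros)
    have eq: "?f = (\<lambda>t. of_real t powr (w - 1) / of_real (exp t))"
      by (auto simp: exp_minus divide_inverse)
    show "?f absolutely_integrable_on {0<..} \<and> integral {0<..} ?f = Gamma w"
      unfolding eq using absolutely_integrable_Gamma_integral'[OF w] Gamma_integral_complex'[OF w]
      by (auto simp: integral_unique)
  qed
  from lborel_has_bochner_integral_real_affine_iff[THEN iffD1, OF _ this, of x 0]
  have "has_bochner_integral lborel (\<lambda>t. indicator {0<..} (x * t) *\<^sub>R ?f (x * t)) (Gamma w /\<^sub>R x)"
    using x by simp
  \<comment> \<open>The factor \<open>x\<close> undoes the Jacobian, and \<open>x powr (-w)\<close> turns \<open>(x t) powr (w - 1)\<close> into \<open>t powr (w - 1) / x\<close>.\<close>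
  hence "has_bochner_integral lborel (\<lambda>t. of_real x * (of_real x powr (- w) * 
             (indicator {0<..} (x * t) *\<^sub>R ?f (x * t))))
          (of_real x * (of_real x powr (- w) * (Gamma w /\<^sub>R x)))"
    by (intro has_bochner_integral_mult_right)
  also have "of_real x * (of_real x powr (- w) * (Gamma w /\<^sub>R x)) =
             Gamma w * of_real x powr (- w)"
    using x by (simp add: scaleR_conv_of_real field_simps)
  also have "(\<lambda>t. of_real x * (of_real x powr (- w) * 
             (indicator {0<..} (x * t) *\<^sub>R ?f (x * t)))) =
     (\<lambda>t. indicator {0<..} t *\<^sub>R (of_real t powr (w - 1) * of_real (exp (- (x * t)))))"
  proof
    fix t :: real
    show "of_real x * (of_real x powr (- w) * 
             (indicator {0<..} (x * t) *\<^sub>R ?f (x * t))) =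
          indicator {0<..} t *\<^sub>R (of_real t powr (w - 1) * of_real (exp (- (x * t))))"
    proof (cases "t > 0")
      case True
      have "complex_of_real (x * t) powr (w - 1) = of_real x powr (w - 1) * of_real t powr (w - 1)"
        using True x by (simp add: powr_times_real)
      moreover have "of_real x * (of_real x powr (- w) * of_real x powr (w - 1)) = (1 :: complex)"
        using x by (simp add: powr_minus powr_diff field_simps)
      ultimately show ?thesis using True x
        by (simp add: zero_less_mult_iff mult_ac)
    qed (use x in \<open>auto simp: zero_less_mult_iff\<close>)
  qed
  finally show ?thesis .
qed

lemma has_bochner_integral_Gamma_real:
  fixes w x :: real
  assumes w: "w > 0" and x: "x > 0"
  shows "has_bochner_integral lborel
           (\<lambda>t. indicator {0<..} t * (t powr (w - 1) * exp (- (x * t))))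
           (Gamma w * x powr (- w))"
proof -
  have "has_bochner_integral lborel
     (\<lambda>t. Re (indicator {0<..} t *\<^sub>R (of_real t powr (of_real w - 1) * of_real (exp (- (x * t))))))
     (Re (Gamma (of_real w) * of_real x powr (- of_real w)))"
    by (intro has_bochner_integral_bounded_linear[OF bounded_linear_Re] has_bochner_integral_Gamma)
       (use assms in auto)
  also have "Re (Gamma (of_real w) * of_real x powr (- of_real w)) = Gamma w * x powr (-w)"
    using x by (simp add: Gamma_complex_of_real powr_of_real flip: of_real_minus)
  also have "(\<lambda>t. Re (indicator {0<..} t *\<^sub>R (of_real t powr (of_real w - 1) * of_real (exp (- (x * t)))))) =
        (\<lambda>t. indicator {0<..} t * (t powr (w - 1) * exp (- (x * t))))"
  proof
    fix t :: real
    have "complex_of_real t powr (of_real w - 1) = of_real (t powr (w - 1))" if "t > 0"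
      using powr_of_real[of t "w - 1"] that by simp
    thus "Re (indicator {0<..} t *\<^sub>R (of_real t powr (of_real w - 1) * of_real (exp (- (x * t))))) =
            indicator {0<..} t * (t powr (w - 1) * exp (- (x * t)))"
      by (cases "t > 0") auto
  qed
  finally show ?thesis .
qed

lemma Gamma_nonzero_of_Re_pos:
  "Re z > 0 \<Longrightarrow> Gamma z \<noteq> 0"
  by (auto intro!: Gamma_nonzero elim!: nonpos_Ints_cases simp del: Gamma_eq_zero_iff)

text \<open>
  The integrand, multiplied by \<open>Gamma (w + v)\<close>, is itself an integral over \<open>x\<close>, because
  \<open>Gamma (w + v) (t + a) powr (-(w + v))\<close> is the Gamma integral with exponential factor \<open>exp (-(t + a) x)\<close>.
  Exchanging the order of integration and integrating over \<open>t\<close> first leaves \<open>Gamma w\<close> times the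
  Gamma integral for \<open>v\<close> with exponential factor \<open>exp (-a x)\<close>. The same computation with \<open>Re w\<close> and \<open>Re v\<close> in place
  of \<open>w\<close> and \<open>v\<close> bounds the absolute values and so justifies the exchange.
\<close>

lemma has_bochner_integral_Beta_Ioi:
  fixes w v :: complex and a :: real
  assumes w: "Re w > 0" and v: "Re v > 0" and a: "a > 0"
  shows "has_bochner_integral lborel
           (\<lambda>t. indicator {0<..} t *\<^sub>R (of_real t powr (w - 1) * of_real (t + a) powr (- (w + v))))
           (Beta w v * of_real a powr (- v))"
proof -
  define f :: "real \<Rightarrow> real \<Rightarrow> complex" where "f = (\<lambda>x t. (indicator {0<..} x * indicator {0<..} t) *\<^sub>R
     (of_real t powr (w - 1) * of_real x powr (w + v - 1) * of_real (exp (- ((t + a) * x)))))"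
  have f1: "f x t = indicator {0<..} x *\<^sub>R (of_real x powr (w + v - 1) * of_real (exp (- (a * x))) *
              (indicator {0<..} t *\<^sub>R (of_real t powr (w - 1) * of_real (exp (- (x * t))))))" for x t
  proof -
    have "exp (- ((t + a) * x)) = exp (- (a * x)) * exp (- (x * t))"
      by (simp add: algebra_simps flip: exp_add)
    thus ?thesis by (simp add: f_def scaleR_conv_of_real mult_ac)
  qed
  have f2: "f x t = indicator {0<..} t *\<^sub>R (of_real t powr (w - 1) * 
              (indicator {0<..} x *\<^sub>R (of_real x powr (w + v - 1) * of_real (exp (- ((t + a) * x))))))" for x t
    by (simp add: f_def scaleR_conv_of_real)
  have norm_f: "norm (f x t) = indicator {0<..} x * (x powr (Re w + Re v - 1) * exp (- (a * x)) *
              (indicator {0<..} t * (t powr (Re w - 1) * exp (- (x * t)))))" for x t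
    by (auto simp: f1 indicator_def norm_mult norm_of_real_powr)
  have inner1: "has_bochner_integral lborel (\<lambda>t. f x t) (Gamma w * (indicator {0<..} x *\<^sub>R 
         (of_real x powr (v - 1) * of_real (exp (- (a * x))))))" for x
  proof (cases "x > 0")
    case True
    have "has_bochner_integral lborel (\<lambda>t. f x t) (indicator {0<..} x *\<^sub>R 
         (of_real x powr (w + v - 1) * of_real (exp (- (a * x))) * (Gamma w * of_real x powr (- w))))"
      unfolding f1 using True w
      by (intro has_bochner_integral_mult_right has_bochner_integral_scaleR_right has_bochner_integral_Gamma)
    also have "of_real x powr (w + v - 1) * of_real (exp (- (a * x))) * (Gamma w * of_real x powr (- w)) =
         Gamma w * (of_real x powr (v - 1) * of_real (exp (- (a * x))))"
      using True by (simp add: powr_minus powr_diff powr_add field_simps)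
    finally show ?thesis by (simp add: scaleR_conv_of_real mult_ac)
  next
    case False
    thus ?thesis by (simp add: f_def has_bochner_integral_zero)
  qed
  have inner1': "has_bochner_integral lborel (\<lambda>t. norm (f x t)) (Gamma (Re w) * (indicator {0<..} x * 
         (x powr (Re v - 1) * exp (- (a * x)))))" for x
  proof (cases "x > 0")
    case True
    have "has_bochner_integral lborel (\<lambda>t. norm (f x t)) (indicator {0<..} x * 
         (x powr (Re w + Re v - 1) * exp (- (a * x)) * (Gamma (Re w) * x powr (- Re w))))"
      unfolding norm_f using True w
      by (intro has_bochner_integral_mult_right has_bochner_integral_Gamma_real)
    also have "x powr (Re w + Re v - 1) * exp (- (a * x)) * (Gamma (Re w) * x powr (- Re w)) =
         Gamma (Re w) * (x powr (Re v - 1) * exp (- (a * x)))"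
      using True by (simp add: powr_minus powr_diff powr_add field_simps)
    finally show ?thesis by (simp add: mult_ac)
  next
    case False
    thus ?thesis by (simp add: f_def has_bochner_integral_zero)
  qed
  have inner2: "has_bochner_integral lborel (\<lambda>x. f x t) (Gamma (w + v) * (indicator {0<..} t *\<^sub>R 
         (of_real t powr (w - 1) * of_real (t + a) powr (- (w + v)))))" for t
  proof (cases "t > 0")
    case True
    have "has_bochner_integral lborel (\<lambda>x. f x t) (indicator {0<..} t *\<^sub>R 
         (of_real t powr (w - 1) * (Gamma (w + v) * of_real (t + a) powr (- (w + v)))))"
      unfolding f2 using True w v a
      by (intro has_bochner_integral_mult_right has_bochner_integral_scaleR_right has_bochner_integral_Gamma) auto
    thus ?thesis by (simp add: scaleR_conv_of_real mult_ac)
  next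
    case False
    thus ?thesis by (simp add: f_def has_bochner_integral_zero)
  qed
  have meas_powr: "(\<lambda>t. indicator {0<..} t *\<^sub>R complex_of_real t powr u) \<in> borel_measurable borel" for u
    by (intro borel_measurable_continuous_on_indicator continuous_intros) auto
  have meas: "case_prod f \<in> borel_measurable (lborel \<Otimes>\<^sub>M lborel)"
  proof -
    have "case_prod f = (\<lambda>p. (indicator {0<..} (snd p) *\<^sub>R complex_of_real (snd p) powr (w - 1)) *
             (indicator {0<..} (fst p) *\<^sub>R complex_of_real (fst p) powr (w + v - 1)) *
             of_real (exp (- ((snd p + a) * fst p))))"
      by (auto simp: f_def scaleR_conv_of_real fun_eq_iff)
    also have "\<dots> \<in> borel_measurable (lborel \<Otimes>\<^sub>M lborel)"
      using meas_powr by measurable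
    finally show ?thesis .
  qed
  have int: "integrable (lborel \<Otimes>\<^sub>M lborel) (case_prod f)"
  proof (rule lborel_pair.Fubini_integrable[OF meas])
    \<comment> \<open>Integrating the absolute value over \<open>t\<close> leaves the real Gamma integral for \<open>Re v\<close>.\<close>
    have "integrable lborel (\<lambda>x. Gamma (Re w) * (indicator {0<..} x * (x powr (Re v - 1) * exp (- (a * x)))))"
      using has_bochner_integral_Gamma_real[OF v a] by (intro integrable_mult_right) (auto simp: has_bochner_integral_iff)
    thus "integrable lborel (\<lambda>x. LBINT y. norm (case (x, y) of (x, y) \<Rightarrow> f x y))"
      unfolding prod.case has_bochner_integral_integral_eq[OF inner1'] .
  qed (use inner1 in \<open>auto simp: has_bochner_integral_iff\<close>)
  have G: "Gamma (w + v) \<noteq> 0"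
    using w v by (intro Gamma_nonzero_of_Re_pos) auto
  have I2: "has_bochner_integral lborel (\<lambda>t. Gamma (w + v) * (indicator {0<..} t *\<^sub>R 
         (of_real t powr (w - 1) * of_real (t + a) powr (- (w + v))))) (Gamma w * (Gamma v * of_real a powr (- v)))"
  proof -
    have "(LBINT x. f x t) = Gamma (w + v) * (indicator {0<..} t *\<^sub>R 
         (of_real t powr (w - 1) * of_real (t + a) powr (- (w + v))))" for t
      using inner2 by (rule has_bochner_integral_integral_eq)
    note inner_x = this
    have "(LBINT t. f x t) = Gamma w * (indicator {0<..} x *\<^sub>R 
         (of_real x powr (v - 1) * of_real (exp (- (a * x)))))" for x
      using inner1 by (rule has_bochner_integral_integral_eq)
    note inner_t = this
    have "(LBINT t. LBINT x. f x t) = (LBINT x. LBINT t. f x t)"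
      by (rule lborel_pair.Fubini_integral[OF int])
    also have "\<dots> = Gamma w * (Gamma v * of_real a powr (- v))"
      unfolding inner_t using has_bochner_integral_Gamma[OF v a]
      by (intro has_bochner_integral_integral_eq has_bochner_integral_mult_right)
    finally have "(LBINT t. LBINT x. f x t) = Gamma w * (Gamma v * of_real a powr (- v))" .
    moreover have "integrable lborel (\<lambda>t. LBINT x. f x t)"
      by (rule lborel_pair.integrable_snd[OF int])
    ultimately show ?thesis unfolding inner_x by (simp add: has_bochner_integral_iff)
  qed
  have "has_bochner_integral lborel (\<lambda>t. 1 / Gamma (w + v) * (Gamma (w + v) * (indicator {0<..} t *\<^sub>R 
         (of_real t powr (w - 1) * of_real (t + a) powr (- (w + v)))))) 
          (1 / Gamma (w + v) * (Gamma w * (Gamma v * of_real a powr (- v))))"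
    by (intro has_bochner_integral_mult_right I2)
  thus ?thesis using G by (simp add: Beta_def mult.assoc)
qed

section \<open>Partial fractions of the hyperbolic cotangent\<close>

text \<open>
  This is the derivative of the reflection formula \<open>rGamma z * rGamma (1 - z) = sin (pi z) / pi\<close>, divided by
  the formula itself.
\<close>

lemma Digamma_reflection_complex:
  fixes z :: complex
  assumes "z \<notin> \<int>"
  shows "Digamma (1 - z) - Digamma z = of_real pi * cot (of_real pi * z)"
proof -
  have z: "z \<notin> \<int>\<^sub>\<le>\<^sub>0" "1 - z \<notin> \<int>\<^sub>\<le>\<^sub>0"
    using assms nonpos_Ints_Int Ints_1 Ints_diff[of 1 "1 - z"] by auto
  have reflection: "(\<lambda>z. rGamma z * rGamma (1 - z)) = (\<lambda>z::complex. sin (of_real pi * z) / of_real pi)"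
    using rGamma_reflection_complex by auto
  have "((\<lambda>z. rGamma z * rGamma (1 - z)) has_field_derivative
          rGamma z * rGamma (1 - z) * (Digamma (1 - z) - Digamma z)) (at z)"
    using z by (auto intro!: derivative_eq_intros simp: algebra_simps)
  hence "((\<lambda>z. sin (of_real pi * z) / of_real pi) has_field_derivative
          rGamma z * rGamma (1 - z) * (Digamma (1 - z) - Digamma z)) (at z)"
    unfolding reflection .
  moreover have "((\<lambda>z. sin (of_real pi * z) / of_real pi) has_field_derivative
          cos (of_real pi * z)) (at z)"
    by (auto intro!: derivative_eq_intros)
  ultimately have "sin (of_real pi * z) / of_real pi * (Digamma (1 - z) - Digamma z) = cos (of_real pi * z)"
    using DERIV_unique rGamma_reflection_complex[of z] by metis
  moreover have "sin (of_real pi * z) \<noteq> 0"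
    using assms sin_eq_0[of "of_real pi * z"] by (auto simp: mult_ac)
  ultimately show ?thesis
    by (simp add: cot_def field_simps)
qed

text \<open>
  At \<open>z = \<i> s / pi\<close> the cotangent in the reflection formula for \<open>Digamma\<close> is \<open>-\<i> coth s\<close>. Replacing
  \<open>Digamma z\<close> by \<open>Digamma (1 + z) - 1 / z\<close> makes the defining series of the two Digamma values
  match termwise: the terms with index \<open>k\<close> differ by the two conjugate fractions that combine
  to a multiple of \<open>1 / (s\<^sup>2 + ((k + 1) pi)\<^sup>2)\<close>.
\<close>

lemma coth_sums:
  fixes s :: real
  assumes s: "s \<noteq> 0"
  shows "(\<lambda>k. 1 / (s\<^sup>2 + (real (Suc k) * pi)\<^sup>2)) sums ((s * coth s - 1) / (2 * s\<^sup>2))"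
proof -
  define z :: complex where "z = \<i> * of_real (s / pi)"
  have zI: "z \<notin> \<int>"
    using s by (auto simp: z_def Ints_def complex_eq_iff)
  have dig: "(\<lambda>k. inverse (of_nat (Suc k)) - inverse (w + of_nat k)) sums (Digamma w + euler_mascheroni)"
    if "w \<noteq> 0" for w :: complex
    using summable_Digamma[OF that] by (simp add: Digamma_def sums_iff)
  have nz: "1 + z \<noteq> 0" "1 - z \<noteq> 0" "z \<noteq> 0" using s by (auto simp: z_def complex_eq_iff)
  have "(\<lambda>k. inverse (of_nat (Suc k)) - inverse (1 - z + of_nat k) - 
               (inverse (of_nat (Suc k)) - inverse (1 + z + of_nat k)))
          sums (Digamma (1 - z) + euler_mascheroni - (Digamma (1 + z) + euler_mascheroni))"
    by (intro sums_diff dig nz)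
  also have "(Digamma (1 - z) + euler_mascheroni - (Digamma (1 + z) + euler_mascheroni)) =
               of_real pi * cot (of_real pi * z) - 1 / z"
    using Digamma_reflection_complex[OF zI] Digamma_plus1[OF nz(3)] by (simp add: algebra_simps)
  also have "of_real pi * z = \<i> * of_real s"
    by (simp add: z_def)
  also have "cot (\<i> * of_real s) = - \<i> * of_real (coth s)"
  proof -
    have "sin (\<i> * of_real s) = \<i> * of_real (sinh s)" "cos (\<i> * of_real s) = of_real (cosh s)"
      by (auto simp: complex_eq_iff Re_sin Im_sin Re_cos Im_cos sinh_field_def cosh_field_def)
    thus ?thesis using s by (simp add: cot_def coth_def field_simps)
  qed
  finally have "(\<lambda>k. Im (inverse (of_nat (Suc k)) - inverse (1 - z + of_nat k) - 
               (inverse (of_nat (Suc k)) - inverse (1 + z + of_nat k))))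
          sums Im (of_real pi * (- \<i> * of_real (coth s)) - 1 / z)"
    by (rule sums_Im)
  also have "Im (of_real pi * (- \<i> * of_real (coth s)) - 1 / z) = pi / s - pi * coth s"
    using s by (simp add: z_def Im_divide power2_eq_square)
  also have "(\<lambda>k. Im (inverse (of_nat (Suc k)) - inverse (1 - z + of_nat k) - 
               (inverse (of_nat (Suc k)) - inverse (1 + z + of_nat k)))) =
             (\<lambda>k. -(2 * pi * s) * (1 / (s\<^sup>2 + (real (Suc k) * pi)\<^sup>2)))"
  proof
    fix k :: nat
    define m where "m = real (Suc k)"
    have m: "m > 0" by (simp add: m_def)
    have eq: "1 - z + of_nat k = Complex m (- (s / pi))" "1 + z + of_nat k = Complex m (s / pi)"
      by (auto simp: z_def m_def complex_eq_iff)
    have "Im (inverse (of_nat (Suc k)) - inverse (1 - z + of_nat k) - 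
               (inverse (of_nat (Suc k)) - inverse (1 + z + of_nat k))) = - (2 * (s / pi) / (m\<^sup>2 + (s / pi)\<^sup>2))"
      unfolding eq by simp
    also have "\<dots> = -(2 * pi * s) * (1 / (s\<^sup>2 + (m * pi)\<^sup>2))"
    proof -
      have "m\<^sup>2 + (s / pi)\<^sup>2 > 0" "s\<^sup>2 + (m * pi)\<^sup>2 > 0"
        using m s by (auto intro!: add_pos_nonneg add_nonneg_pos)
      thus ?thesis
        by (simp add: divide_simps) (simp add: power2_eq_square algebra_simps)
    qed
    finally show "Im (inverse (of_nat (Suc k)) - inverse (1 - z + of_nat k) - 
               (inverse (of_nat (Suc k)) - inverse (1 + z + of_nat k))) = 
              -(2 * pi * s) * (1 / (s\<^sup>2 + (real (Suc k) * pi)\<^sup>2))"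
      by (simp only: m_def)
  qed
  finally have "(\<lambda>k. (-1 / (2 * pi * s)) * (-(2 * pi * s) * (1 / (s\<^sup>2 + (real (Suc k) * pi)\<^sup>2)))) sums
     ((-1 / (2 * pi * s)) * (pi / s - pi * coth s))"
    by (rule sums_mult)
  also have "(-1 / (2 * pi * s)) * (pi / s - pi * coth s) = (s * coth s - 1) / (2 * s\<^sup>2)"
    using s by (simp add: field_simps power2_eq_square)
  finally show ?thesis using s by simp
qed

section \<open>Derivatives of the partial fraction series\<close>

text \<open>
  Because every pole \<open>- a k\<close> is at most \<open>-1\<close>, each power of \<open>1 / (t + a k)\<close> is at most \<open>1 / a k\<close> for
  \<open>t \<ge> 0\<close>. So one summable majorant serves all orders of differentiation.
\<close>

lemma has_field_derivative_reciprocal_power_series: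
  fixes a :: "nat \<Rightarrow> real"
  assumes a: "\<And>k. a k \<ge> 1" and summ: "summable (\<lambda>k. 1 / a k)" and t: "t > 0"
  shows "((\<lambda>t. \<Sum>k. 1 / (t + a k) ^ Suc n) has_field_derivative
            (- real (Suc n) * (\<Sum>k. 1 / (t + a k) ^ Suc (Suc n)))) (at t)"
    and "summable (\<lambda>k. 1 / (t + a k) ^ Suc n)"
proof -
  have bound: "1 / (x + a k) ^ Suc m \<le> 1 / a k" if "x \<ge> 0" for x k m
  proof (rule divide_left_mono)
    have "a k \<le> (x + a k) ^ 1" using that by simp
    also have "\<dots> \<le> (x + a k) ^ Suc m"
      using a[of k] that by (intro power_increasing) auto
    finally show "a k \<le> (x + a k) ^ Suc m" .
    show "0 < (x + a k) ^ Suc m * a k"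
      using a[of k] that by (intro mult_pos_pos zero_less_power) auto
  qed simp
  have summable_pos: "summable (\<lambda>k. 1 / (x + a k) ^ Suc m)" if "x \<ge> 0" for x m
  proof (rule summable_comparison_test'[OF summ])
    fix k show "norm (1 / (x + a k) ^ Suc m) \<le> 1 / a k"
      using bound[OF that, of k m] a[of k] that by (auto simp: abs_of_nonneg)
  qed
  show "summable (\<lambda>k. 1 / (t + a k) ^ Suc n)"
    using summable_pos t by simp
  let ?f' = "\<lambda>k x. - real (Suc n) * (1 / (x + a k) ^ Suc (Suc n))"
  have "((\<lambda>t. \<Sum>k. 1 / (t + a k) ^ Suc n) has_field_derivative (\<Sum>k. ?f' k t)) (at t)"
  proof (rule has_field_derivative_series'(2)[of "{0<..}"])
    fix k and x :: real assume x: "x \<in> {0<..}"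
    hence nz: "x + a k \<noteq> 0" using a[of k] by auto
    show "((\<lambda>t. 1 / (t + a k) ^ Suc n) has_field_derivative ?f' k x) (at x within {0<..})"
    proof -
      have "((\<lambda>t. inverse ((t + a k) ^ Suc n)) has_field_derivative
              - (real (Suc n) * (x + a k) ^ n * inverse (((x + a k) ^ Suc n)\<^sup>2))) (at x within {0<..})"
        using nz by (auto intro!: derivative_eq_intros simp: power2_eq_square simp del: of_nat_Suc power_Suc)
      also have "- (real (Suc n) * (x + a k) ^ n * inverse (((x + a k) ^ Suc n)\<^sup>2)) = ?f' k x"
      proof -
        have "y \<noteq> 0 \<Longrightarrow> - (real (Suc n) * y ^ n * inverse ((y ^ Suc n)\<^sup>2)) =
                - real (Suc n) * (1 / y ^ Suc (Suc n))" for y :: real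
          by (simp add: field_simps power2_eq_square del: of_nat_Suc)
        thus ?thesis using nz by blast
      qed
      finally show ?thesis by (simp add: divide_inverse)
    qed
  next
    have "uniform_limit {0<..} (\<lambda>m x. \<Sum>k<m. ?f' k x) (\<lambda>x. \<Sum>k. ?f' k x) sequentially"
    proof (rule Weierstrass_m_test)
      fix k and x :: real assume x: "x \<in> {0<..}"
      thus "norm (?f' k x) \<le> real (Suc n) * (1 / a k)"
        unfolding norm_mult using bound[of x k "Suc n"] a[of k]
        by (intro mult_mono) (auto simp: abs_of_nonneg)
    qed (intro summable_mult summ)
    thus "uniformly_convergent_on {0<..} (\<lambda>m x. \<Sum>k<m. ?f' k x)"
      by (auto simp: uniformly_convergent_on_def)
  qed (use t summable_pos in \<open>auto simp: interior_open\<close>)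
  also have "(\<Sum>k. ?f' k t) = - real (Suc n) * (\<Sum>k. 1 / (t + a k) ^ Suc (Suc n))"
    by (intro suminf_mult summable_pos) (use t in auto)
  finally show "((\<lambda>t. \<Sum>k. 1 / (t + a k) ^ Suc n) has_field_derivative
            (- real (Suc n) * (\<Sum>k. 1 / (t + a k) ^ Suc (Suc n)))) (at t)" .
qed

text \<open>
  For \<open>t > 0\<close> this is the \<open>n\<close>-th derivative at \<open>t\<close> of \<open>(sqrt t * coth (sqrt t) - 1) / (2 * t)\<close>, which the partial fractions of
  \<open>coth\<close> turn into a series of simple poles at \<open>- (k pi)\<^sup>2\<close>.
\<close>

definition pole_sum_deriv :: "nat \<Rightarrow> real \<Rightarrow> real" where
  "pole_sum_deriv n t = (-1) ^ n * fact n * (\<Sum>k. 1 / (t + (real (Suc k) * pi)\<^sup>2) ^ Suc n)"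

lemma pi_multiple_squared_ge_1: "1 \<le> (real (Suc k) * pi)\<^sup>2"
proof -
  have "1 * 1 \<le> real (Suc k) * pi"
    using pi_gt3 by (intro mult_mono) auto
  thus ?thesis by (metis mult_1 one_le_power)
qed

lemma summable_inverse_pi_multiples_squared: "summable (\<lambda>k. 1 / (real (Suc k) * pi)\<^sup>2)"
proof -
  have "summable (\<lambda>k. (1 / pi\<^sup>2) * (1 / real (Suc k) ^ 2))"
    using inverse_power_summable[of 2, where ?'a = real]
    by (intro summable_mult) (subst summable_Suc_iff, simp add: divide_inverse)
  thus ?thesis by (simp add: power_mult_distrib mult_ac)
qed

lemma has_field_derivative_pole_sum_deriv:
  assumes "t > 0"
  shows "(pole_sum_deriv n has_field_derivative pole_sum_deriv (Suc n) t) (at t)"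
  unfolding pole_sum_deriv_def
  by (rule derivative_eq_intros refl assms pi_multiple_squared_ge_1 summable_inverse_pi_multiples_squared
        has_field_derivative_reciprocal_power_series)+
     (simp add: algebra_simps)

lemma pole_sum_deriv_0:
  assumes "s \<noteq> 0"
  shows "pole_sum_deriv 0 (s\<^sup>2) = (s * coth s - 1) / (2 * s\<^sup>2)"
  using sums_unique[OF coth_sums[OF assms]] by (simp add: pole_sum_deriv_def)

lemma funpow_deriv_eq:
  fixes F :: "nat \<Rightarrow> real \<Rightarrow> real"
  assumes f: "\<And>t. t > 0 \<Longrightarrow> f t = F 0 t"
    and F: "\<And>n t. t > 0 \<Longrightarrow> (F n has_field_derivative F (Suc n) t) (at t)"
    and t: "t > 0"
  shows "(deriv ^^ n) f t = F n t"
  using t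
proof (induction n arbitrary: t)
  case (Suc n)
  have "((deriv ^^ n) f has_field_derivative F (Suc n) t) (at t)"
    by (rule has_field_derivative_transform_within_open[OF F, of t "{0<..}"]) (use Suc in auto)
  thus ?case by (simp add: DERIV_imp_deriv)
qed (use f in auto)

text \<open>
  The value at \<open>s > 0\<close> only sees \<open>f\<close> near \<open>s\<close>, so agreement on the positive half-line suffices.
  Writing the derivative as \<open>s * c\<close> absorbs the factor \<open>1 / s\<close> of the operator.
\<close>

lemma radial_deriv_eqI:
  assumes f: "\<And>s. s > 0 \<Longrightarrow> f s = g s"
    and g: "(g has_field_derivative s * c) (at s)" and s: "s > 0"
  shows "radial_deriv f s = c"
proof -
  have "(f has_field_derivative s * c) (at s)"
    by (rule has_field_derivative_transform_within_open[OF g, of "{0<..}"]) (use f s in auto)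
  thus ?thesis using s by (simp add: DERIV_imp_deriv radial_deriv_def)
qed

lemma funpow_radial_deriv_eq:
  fixes F :: "nat \<Rightarrow> real \<Rightarrow> real"
  assumes f: "\<And>s. s > 0 \<Longrightarrow> f s = F 0 s"
    and F: "\<And>n s. s > 0 \<Longrightarrow> (F n has_field_derivative s * F (Suc n) s) (at s)"
    and s: "s > 0"
  shows "(radial_deriv ^^ n) f s = F n s"
  using s
proof (induction n arbitrary: s)
  case (Suc n)
  have "radial_deriv ((radial_deriv ^^ n) f) s = F (Suc n) s"
    using Suc.IH F[OF Suc.prems] Suc.prems by (rule radial_deriv_eqI)
  thus ?case by simp
qed (use f in auto)

lemma funpow_deriv_eq_pole_sum_deriv:
  assumes "t > 0"
  shows "(deriv ^^ n) (\<lambda>x. inverse (2 * x) * (sqrt x * coth (sqrt x) - 1)) t = pole_sum_deriv n t"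
proof (rule funpow_deriv_eq[where F = pole_sum_deriv, OF _ has_field_derivative_pole_sum_deriv assms])
  fix t :: real assume "t > 0"
  thus "inverse (2 * t) * (sqrt t * coth (sqrt t) - 1) = pole_sum_deriv 0 t"
    using pole_sum_deriv_0[of "sqrt t"] by (simp add: field_simps)
qed

text \<open>
  In the variable \<open>t = s\<^sup>2\<close> the operator \<open>(1 / s) d/ds\<close> is \<open>2 d/dt\<close>, and the starting function is twice
  the one in \<open>t\<close>; hence the power \<open>2 ^ Suc n\<close>.
\<close>

lemma funpow_radial_deriv_eq_pole_sum_deriv:
  assumes "s > 0"
  shows "(radial_deriv ^^ n) (\<lambda>x. x powi (-2) * (x * coth x - 1)) s = 2 ^ Suc n * pole_sum_deriv n (s\<^sup>2)"
proof (rule funpow_radial_deriv_eq[where F = "\<lambda>n s. 2 ^ Suc n * pole_sum_deriv n (s\<^sup>2)", OF _ _ assms])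
  fix s :: real assume "s > 0"
  thus "s powi (-2) * (s * coth s - 1) = 2 ^ Suc 0 * pole_sum_deriv 0 (s\<^sup>2)"
    using pole_sum_deriv_0[of s] by (simp add: field_simps power_int_minus)
next
  fix n and s :: real assume "s > 0"
  thus "((\<lambda>s. 2 ^ Suc n * pole_sum_deriv n (s\<^sup>2)) has_field_derivative
           s * (2 ^ Suc (Suc n) * pole_sum_deriv (Suc n) (s\<^sup>2))) (at s)"
    by (auto intro!: derivative_eq_intros DERIV_chain2[OF has_field_derivative_pole_sum_deriv] simp: mult_ac)
qed

section \<open>Termwise integration\<close>

text \<open>
  The Beta integral with \<open>w = 1 - z\<close> and \<open>v = n + z\<close>, chosen so that \<open>w + v = n + 1\<close>.
\<close>

lemma has_bochner_integral_power_denominator: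
  assumes z: "0 < Re z" "Re z < 1" and a: "a > 0"
  shows "has_bochner_integral lborel
           (\<lambda>t. indicator {0<..} t *\<^sub>R (of_real t powr (- z) * of_real (1 / (t + a) ^ Suc n)))
           (Gamma (1 - z) * Gamma (of_nat n + z) / fact n * of_real a powr (- (of_nat n + z)))"
proof -
  have "has_bochner_integral lborel
           (\<lambda>t. indicator {0<..} t *\<^sub>R (of_real t powr (1 - z - 1) * of_real (t + a) powr (- (1 - z + (of_nat n + z)))))
           (Beta (1 - z) (of_nat n + z) * of_real a powr (- (of_nat n + z)))"
    using z a by (intro has_bochner_integral_Beta_Ioi) (auto simp: add_nonneg_pos)
  also have "Beta (1 - z) (of_nat n + z) = Gamma (1 - z) * Gamma (of_nat n + z) / fact n"
    by (simp add: Beta_def Gamma_fact)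
  also have "(\<lambda>t. indicator {0<..} t *\<^sub>R (of_real t powr (1 - z - 1) * of_real (t + a) powr (- (1 - z + (of_nat n + z))))) =
     (\<lambda>t. indicator {0<..} t *\<^sub>R (of_real t powr (- z) * of_real (1 / (t + a) ^ Suc n)))"
  proof
    fix t :: real
    have "of_real (t + a) powr (- (1 - z + (of_nat n + z))) = complex_of_real (1 / (t + a) ^ Suc n)" if "t > 0"
    proof -
      have "of_real (t + a) powr (- (1 - z + (of_nat n + z))) = of_real (t + a) powr (- of_nat (Suc n))"
        by (rule arg_cong) simp
      also have "\<dots> = inverse (complex_of_real (t + a) powr of_nat (Suc n))"
        by (rule powr_minus)
      also have "\<dots> = inverse (of_real (t + a) ^ Suc n)"
        using that a by (subst powr_nat') (auto simp flip: of_real_add)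
      finally show ?thesis by (simp add: divide_inverse)
    qed
    thus "indicator {0<..} t *\<^sub>R (of_real t powr (1 - z - 1) * of_real (t + a) powr (- (1 - z + (of_nat n + z)))) =
     indicator {0<..} t *\<^sub>R (of_real t powr (- z) * complex_of_real (1 / (t + a) ^ Suc n))"
      by (cases "t > 0") auto
  qed
  finally show ?thesis .
qed

lemma of_real_power2_powr:
  "x > 0 \<Longrightarrow> complex_of_real (x\<^sup>2) powr w = of_real x powr (2 * w)"
  by (simp add: powr_def Ln_of_real ln_realpow mult_ac flip: of_real_power)

lemma summable_zeta:
  assumes "Re w > 1"
  shows "summable (\<lambda>k. norm (of_nat (Suc k) powr (- w) :: complex))"
proof -
  have "summable (\<lambda>k. real (Suc k) powr (- Re w))"
    using assms by (subst summable_Suc_iff) (simp add: summable_real_powr_iff)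
  moreover have "norm (of_nat (Suc k) powr (- w) :: complex) = real (Suc k) powr (- Re w)" for k
    using norm_of_real_powr[of "real (Suc k)" "- w"] by simp
  ultimately show ?thesis by simp
qed

text \<open>
  Each pole \<open>a = ((k + 1) pi)\<^sup>2\<close> contributes a Beta integral proportional to
  \<open>a powr (-(n + z)) = ((k + 1) pi) powr (-(2 n + 2 z))\<close>, that is, to a term of the zeta series. The absolute
  values of the integrands are the integrands for \<open>Re z\<close> in place of \<open>z\<close>; their integrals form a
  multiple of the series for \<open>zeta (2 n + 2 Re z)\<close>, which converges as \<open>Re (2 n + 2 z) > 1\<close>. So sum and
  integral may be exchanged.
\<close>

lemma has_bochner_integral_pole_sum_deriv:
  assumes z: "0 < Re z" "Re z < 1" "Re (2 * of_nat n + 2 * z) > 1"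
  shows "has_bochner_integral lborel
           (\<lambda>t. indicator {0<..} t *\<^sub>R (of_real t powr (- z) * of_real (pole_sum_deriv n t)))
           ((-1) ^ n * (Gamma (1 - z) * Gamma (of_nat n + z)) * of_real pi powr (- (2 * (of_nat n + z))) *
             zeta (2 * of_nat n + 2 * z))"
proof -
  define a :: "nat \<Rightarrow> real" where "a = (\<lambda>k. (real (Suc k) * pi)\<^sup>2)"
  have a1: "a k \<ge> 1" for k unfolding a_def by (rule pi_multiple_squared_ge_1)
  have a0: "a k > 0" for k using a1[of k] by linarith
  have summ: "summable (\<lambda>k. 1 / a k)" unfolding a_def by (rule summable_inverse_pi_multiples_squared)
  have a_powr: "complex_of_real (a k) powr (- (of_nat n + u)) = 
          of_real pi powr (- (2 * (of_nat n + u))) * of_nat (Suc k) powr (- (2 * of_nat n + 2 * u))" for k u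
  proof -
    have "complex_of_real (a k) powr (- (of_nat n + u)) = 
            (of_nat (Suc k) * of_real pi) powr (- (2 * (of_nat n + u)))"
      unfolding a_def by (subst of_real_power2_powr) simp_all
    also have "\<dots> = of_nat (Suc k) powr (- (2 * (of_nat n + u))) * of_real pi powr (- (2 * (of_nat n + u)))"
      by (rule powr_times_real) auto
    finally show ?thesis by (simp add: algebra_simps)
  qed
  define f where "f = (\<lambda>k t. indicator {0<..} t *\<^sub>R (of_real t powr (- z) * complex_of_real (1 / (t + a k) ^ Suc n)))"
  define C where "C = (\<lambda>u. Gamma (1 - u) * Gamma (of_nat n + u) / fact n * complex_of_real pi powr (- (2 * (of_nat n + u))))"
  have f_int: "has_bochner_integral lborel (f k) (C z * of_nat (Suc k) powr (- (2 * of_nat n + 2 * z)))" for k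
    using has_bochner_integral_power_denominator[OF z(1,2) a0[of k], of n]
    unfolding f_def C_def a_powr by (simp add: mult_ac)
  have norm_int: "(LBINT t. norm (f k t)) = Re (C (of_real (Re z)) * of_nat (Suc k) powr (- (2 * of_nat n + 2 * of_real (Re z))))" for k
  proof -
    have "has_bochner_integral lborel
           (\<lambda>t. Re (indicator {0<..} t *\<^sub>R (of_real t powr (- of_real (Re z)) * of_real (1 / (t + a k) ^ Suc n))))
           (Re (C (of_real (Re z)) * of_nat (Suc k) powr (- (2 * of_nat n + 2 * of_real (Re z)))))"
      using has_bochner_integral_power_denominator[of "of_real (Re z)" "a k" n] z(1,2) a0
      unfolding C_def a_powr 
      by (intro has_bochner_integral_bounded_linear[OF bounded_linear_Re]) (simp add: mult_ac)
    also have "(\<lambda>t. Re (indicator {0<..} t *\<^sub>R (of_real t powr (- of_real (Re z)) * of_real (1 / (t + a k) ^ Suc n)))) =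
                 (\<lambda>t. norm (f k t))"
    proof
      fix t :: real
      have "t + a k > 0" if "t > 0" using a0[of k] that by simp
      thus "Re (indicator {0<..} t *\<^sub>R (of_real t powr (- of_real (Re z)) * of_real (1 / (t + a k) ^ Suc n))) = norm (f k t)"
        by (cases "t > 0")
           (auto simp: f_def norm_mult norm_of_real_powr powr_of_real norm_divide norm_power 
                 simp flip: of_real_minus of_real_add)
    qed
    finally show ?thesis by (rule has_bochner_integral_integral_eq)
  qed
  have f_summable: "summable (\<lambda>k. norm (f k t))" for t
  proof (cases "t > 0")
    case True
    have "norm (f k t) = t powr (- Re z) * (1 / (t + a k) ^ Suc n)" for k
      using True a0[of k] by (simp add: f_def norm_mult norm_of_real_powr norm_divide norm_power flip: of_real_add)
    moreover have "summable (\<lambda>k. t powr (- Re z) * (1 / (t + a k) ^ Suc n))"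
      using has_field_derivative_reciprocal_power_series(2)[OF a1 summ True]
      by (intro summable_mult)
    ultimately show ?thesis by simp
  qed (simp add: f_def)
  have int_summable: "summable (\<lambda>k. LBINT t. norm (f k t))"
    unfolding norm_int using z(3)
    by (intro summable_Re summable_mult summable_norm_cancel[OF summable_zeta]) auto
  have f_integrable: "integrable lborel (f k)" for k
    using f_int[of k] by (simp add: has_bochner_integral_iff)
  have "has_bochner_integral lborel (\<lambda>t. \<Sum>k. f k t) (\<Sum>k. LBINT t. f k t)"
    unfolding has_bochner_integral_iff
    using integrable_suminf[OF f_integrable _ int_summable] integral_suminf[OF f_integrable _ int_summable] f_summable
    by auto
  also have "(\<Sum>k. LBINT t. f k t) = C z * zeta (2 * of_nat n + 2 * z)"
    using z(3) unfolding has_bochner_integral_integral_eq[OF f_int] zeta_def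
    by (intro suminf_mult summable_norm_cancel[OF summable_zeta]) auto
  finally have "has_bochner_integral lborel (\<lambda>t. (-1) ^ n * fact n * (\<Sum>k. f k t)) 
        ((-1) ^ n * fact n * (C z * zeta (2 * of_nat n + 2 * z)))"
    by (intro has_bochner_integral_mult_right)
  also have "(-1) ^ n * fact n * (C z * zeta (2 * of_nat n + 2 * z)) = 
      ((-1) ^ n * (Gamma (1 - z) * Gamma (of_nat n + z)) * of_real pi powr (- (2 * (of_nat n + z))) *
             zeta (2 * of_nat n + 2 * z))"
    by (simp add: C_def)
  also have "(\<lambda>t. (-1) ^ n * fact n * (\<Sum>k. f k t)) = 
     (\<lambda>t. indicator {0<..} t *\<^sub>R (of_real t powr (- z) * of_real (pole_sum_deriv n t)))"
  proof
    fix t :: real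
    show "(-1) ^ n * fact n * (\<Sum>k. f k t) = indicator {0<..} t *\<^sub>R (of_real t powr (- z) * of_real (pole_sum_deriv n t))"
    proof (cases "t > 0")
      case True
      have sm: "summable (\<lambda>k. 1 / (t + a k) ^ Suc n)"
        using has_field_derivative_reciprocal_power_series(2)[OF a1 summ True] .
      have "(\<Sum>k. f k t) = (\<Sum>k. of_real t powr (- z) * complex_of_real (1 / (t + a k) ^ Suc n))"
        using True by (simp add: f_def)
      also have "\<dots> = of_real t powr (- z) * (\<Sum>k. complex_of_real (1 / (t + a k) ^ Suc n))"
        using sm by (intro suminf_mult summable_of_real)
      also have "(\<Sum>k. complex_of_real (1 / (t + a k) ^ Suc n)) = of_real (\<Sum>k. 1 / (t + a k) ^ Suc n)"
        using sm by (rule suminf_of_real [symmetric])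
      finally show ?thesis using True by (simp add: pole_sum_deriv_def a_def)
    qed (simp add: f_def)
  qed
  finally show ?thesis .
qed

text \<open>
  The substitution \<open>t = s\<^sup>2\<close>: from \<open>t powr (-z) dt\<close> it makes \<open>2 s powr (1 - 2 z) ds\<close>.
\<close>

lemma has_bochner_integral_pole_sum_deriv_square:
  assumes z: "0 < Re z" "Re z < 1" "Re (2 * of_nat n + 2 * z) > 1"
  shows "has_bochner_integral lborel
           (\<lambda>s. indicator {0<..} s *\<^sub>R (of_real s powr (1 - 2 * z) * of_real (2 * pole_sum_deriv n (s\<^sup>2))))
           ((-1) ^ n * (Gamma (1 - z) * Gamma (of_nat n + z)) * of_real pi powr (- (2 * (of_nat n + z))) *
             zeta (2 * of_nat n + 2 * z))"
proof -
  let ?f = "\<lambda>t. complex_of_real t powr (- z) * of_real (pole_sum_deriv n t)"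
  let ?g = "\<lambda>s. complex_of_real s powr (1 - 2 * z) * of_real (2 * pole_sum_deriv n (s\<^sup>2))"
  let ?I = "(-1) ^ n * (Gamma (1 - z) * Gamma (of_nat n + z)) * of_real pi powr (- (2 * (of_nat n + z))) *
             zeta (2 * of_nat n + 2 * z)"
  have cont: "continuous_on {0<..} (pole_sum_deriv n)"
    by (rule DERIV_continuous_on) (rule has_field_derivative_at_within[OF has_field_derivative_pole_sum_deriv], simp)
  have cont2: "continuous_on {0<..} (\<lambda>s. pole_sum_deriv n (s\<^sup>2))"
    by (rule continuous_on_compose2[OF cont]) (auto intro!: continuous_intros)
  have cf: "continuous_on {0<..} ?f" and cg: "continuous_on {0<..} ?g"
    by (intro continuous_intros cont cont2)+
  have img: "(\<lambda>s::real. s\<^sup>2) ` {0<..} = {0<..}"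
  proof (intro equalityI subsetI)
    fix t :: real assume "t \<in> {0<..}"
    thus "t \<in> (\<lambda>s::real. s\<^sup>2) ` {0<..}" by (intro image_eqI[of _ _ "sqrt t"]) auto
  qed auto
  have "?f absolutely_integrable_on {0<..} \<and> integral {0<..} ?f = ?I"
    using has_bochner_integral_pole_sum_deriv[OF z] has_bochner_integral_Ioi_iff_absolutely_integrable[OF cf] by simp
  hence "(\<lambda>s. \<bar>2 * s\<bar> *\<^sub>R ?f (s\<^sup>2)) absolutely_integrable_on {0<..} \<and>
           integral {0<..} (\<lambda>s. \<bar>2 * s\<bar> *\<^sub>R ?f (s\<^sup>2)) = ?I"
    by (subst has_absolute_integral_change_of_variables_real[where g = "\<lambda>s. s\<^sup>2"])
       (auto intro!: derivative_eq_intros inj_onI simp: img power2_eq_iff)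
  moreover have "\<bar>2 * s\<bar> *\<^sub>R ?f (s\<^sup>2) = ?g s" if "s \<in> {0<..}" for s
    using that of_real_power2_powr[of s "- z"]
    by (simp add: scaleR_conv_of_real powr_diff powr_minus field_simps)
  ultimately have "?g absolutely_integrable_on {0<..} \<and> integral {0<..} ?g = ?I"
    by (metis (no_types, lifting) integral_cong set_integrable_cong)
  thus ?thesis
    using has_bochner_integral_Ioi_iff_absolutely_integrable[OF cg] by simp
qed

section \<open>Integral representations of zeta\<close>

lemma set_integral_Ioi_pole_sum_deriv:
  assumes z: "0 < Re z" "Re z < 1" "Re (2 * of_nat n + 2 * z) > 1"
    and F: "\<And>t. t > 0 \<Longrightarrow> F t = of_real t powr (- z) * of_real (pole_sum_deriv n t)"
  shows "set_integrable lborel {0<..} F"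
    and "zeta (2 * of_nat n + 2 * z) =
           (-1) ^ n * of_real pi powr (2 * (of_nat n + z)) / (Gamma (1 - z) * Gamma (of_nat n + z)) *
             (LINT t:{0<..}|lborel. F t)"
proof -
  let ?F = "\<lambda>t. of_real t powr (- z) * complex_of_real (pole_sum_deriv n t)"
  have int: "set_integrable lborel {0<..} ?F"
       "(LINT t:{0<..}|lborel. ?F t) = (-1) ^ n * (Gamma (1 - z) * Gamma (of_nat n + z)) *
           of_real pi powr (- (2 * (of_nat n + z))) * zeta (2 * of_nat n + 2 * z)"
    using has_bochner_integral_pole_sum_deriv[OF z] unfolding has_bochner_integral_Ioi_iff by blast+
  have "set_integrable lborel {0<..} F \<longleftrightarrow> set_integrable lborel {0<..} ?F"
    by (rule set_integrable_cong) (auto simp: F)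
  with int show "set_integrable lborel {0<..} F" by blast
  have eq: "(LINT t:{0<..}|lborel. F t) = (LINT t:{0<..}|lborel. ?F t)"
    by (rule set_lebesgue_integral_cong) (auto simp: F)
  have cancel: "Z = e * p / (A * B) * (e * (A * B) * inverse p * Z)"
    if "e * e = 1" "p \<noteq> 0" "A \<noteq> 0" "B \<noteq> 0" for Z e p A B :: complex
  proof -
    have "e * p / (A * B) * (e * (A * B) * inverse p * Z) = (e * e) * Z"
      using that(2-4) by (simp add: field_simps)
    thus ?thesis using that(1) by simp
  qed
  have "Gamma (1 - z) \<noteq> 0" "Gamma (of_nat n + z) \<noteq> 0"
    using z by (simp_all add: Gamma_nonzero_of_Re_pos add_nonneg_pos)
  thus "zeta (2 * of_nat n + 2 * z) =
           (-1) ^ n * of_real pi powr (2 * (of_nat n + z)) / (Gamma (1 - z) * Gamma (of_nat n + z)) *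
             (LINT t:{0<..}|lborel. F t)"
    unfolding eq int(2) unfolding powr_minus
    by (intro cancel) (simp_all flip: power_mult_distrib)
qed

lemma set_integral_Ioi_pole_sum_deriv_square:
  assumes z: "0 < Re z" "Re z < 1" "Re (2 * of_nat n + 2 * z) > 1"
    and G: "\<And>s. s > 0 \<Longrightarrow> G s = of_real s powr (1 - 2 * z) * of_real (2 ^ Suc n * pole_sum_deriv n (s\<^sup>2))"
  shows "set_integrable lborel {0<..} G"
    and "zeta (2 * of_nat n + 2 * z) =
           (-1) ^ n * 2 powi (- int n) * of_real pi powr (2 * (of_nat n + z)) / 
             (Gamma (1 - z) * Gamma (of_nat n + z)) * (LINT s:{0<..}|lborel. G s)"
proof -
  let ?G = "\<lambda>s. of_real s powr (1 - 2 * z) * complex_of_real (2 * pole_sum_deriv n (s\<^sup>2))"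
  have int: "set_integrable lborel {0<..} ?G"
       "(LINT s:{0<..}|lborel. ?G s) = (-1) ^ n * (Gamma (1 - z) * Gamma (of_nat n + z)) *
           of_real pi powr (- (2 * (of_nat n + z))) * zeta (2 * of_nat n + 2 * z)"
    using has_bochner_integral_pole_sum_deriv_square[OF z] unfolding has_bochner_integral_Ioi_iff by blast+
  have "set_integrable lborel {0<..} (\<lambda>s. 2 ^ n * ?G s)"
    using int(1) by simp
  also have "?this \<longleftrightarrow> set_integrable lborel {0<..} G"
    by (rule set_integrable_cong) (auto simp: G)
  finally show "set_integrable lborel {0<..} G" .
  have "(LINT s:{0<..}|lborel. G s) = (LINT s:{0<..}|lborel. 2 ^ n * ?G s)"
    by (rule set_lebesgue_integral_cong) (auto simp: G)
  also have "\<dots> = 2 ^ n * (LINT s:{0<..}|lborel. ?G s)"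
    by (rule set_integral_mult_right)
  finally have eq: "(LINT s:{0<..}|lborel. G s) = 2 ^ n * (LINT s:{0<..}|lborel. ?G s)" .
  have cancel: "Z = e * u * p / (A * B) * (v * (e * (A * B) * inverse p * Z))"
    if "e * e = 1" "u * v = 1" "p \<noteq> 0" "A \<noteq> 0" "B \<noteq> 0" for Z e u v p A B :: complex
  proof -
    have "e * u * p / (A * B) * (v * (e * (A * B) * inverse p * Z)) = (e * e) * (u * v) * Z"
      using that(3-5) by (simp add: field_simps)
    thus ?thesis using that by simp
  qed
  have "Gamma (1 - z) \<noteq> 0" "Gamma (of_nat n + z) \<noteq> 0"
    using z by (simp_all add: Gamma_nonzero_of_Re_pos add_nonneg_pos)
  thus "zeta (2 * of_nat n + 2 * z) =
           (-1) ^ n * 2 powi (- int n) * of_real pi powr (2 * (of_nat n + z)) / 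
             (Gamma (1 - z) * Gamma (of_nat n + z)) * (LINT s:{0<..}|lborel. G s)"
    unfolding eq int(2) unfolding powr_minus
    by (intro cancel) (simp_all add: power_int_minus flip: power_mult_distrib)
qed

text \<open>
  At \<open>z = 1 / 2\<close> the power of \<open>s\<close> in the second representation disappears and the argument of zeta is
  the odd number \<open>2 n + 1\<close>. The bound \<open>Re (2 n + 2 z) > 1\<close> then means \<open>n > 0\<close>.
\<close>

lemma zeta_odd_integral:
  fixes R :: "real \<Rightarrow> real"
  assumes n: "n > 0"
    and R: "\<And>s. s > 0 \<Longrightarrow> R s = (radial_deriv ^^ n) (\<lambda>x. x powi (-2) * (x * coth x - 1)) s"
  shows "set_integrable lborel {0<..} R"
    and "zeta (of_nat (2 * n + 1)) =
           of_real ((-1) ^ n * pi ^ (2 * n + 1) / (2 ^ n * (Gamma (1 / 2) * Gamma (real n + 1 / 2))) *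
             (LINT s:{0<..}|lborel. R s))"
proof -
  have z: "0 < Re (1 / 2)" "Re (1 / 2) < 1" "Re (2 * of_nat n + 2 * (1 / 2)) > 1"
    using n by auto
  have R': "complex_of_real (R s) = of_real s powr (1 - 2 * (1 / 2)) * of_real (2 ^ Suc n * pole_sum_deriv n (s\<^sup>2))"
    if "s > 0" for s
    using that by (simp only: R funpow_radial_deriv_eq_pole_sum_deriv) simp
  note * = set_integral_Ioi_pole_sum_deriv_square[where G = "\<lambda>s. of_real (R s)", OF z R']
  show "set_integrable lborel {0<..} R"
    using *(1) complex_of_real_integrable_eq[of lborel "\<lambda>s. indicator {0<..} s * R s"]
    by (simp add: set_integrable_def scaleR_conv_of_real)
  have int: "(LINT s:{0<..}|lborel. complex_of_real (R s)) = of_real (LINT s:{0<..}|lborel. R s)"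
    by (rule set_integral_complex_of_real)
  have pow: "complex_of_real pi powr (2 * (of_nat n + 1 / 2)) = of_real (pi ^ (2 * n + 1))"
  proof -
    have "complex_of_real pi powr (2 * (of_nat n + 1 / 2)) = of_real pi powr of_nat (2 * n + 1)"
      by (rule arg_cong) simp
    thus ?thesis by (subst (asm) powr_nat') auto
  qed
  have half: "Gamma (1 - 1 / 2) = complex_of_real (Gamma (1 / 2))"
    using Gamma_complex_of_real[of "1 / 2"] by simp
  have gam: "Gamma (of_nat n + 1 / 2) = complex_of_real (Gamma (real n + 1 / 2))"
    using Gamma_complex_of_real[of "real n + 1 / 2"] by simp
  have "zeta (of_nat (2 * n + 1)) = zeta (2 * of_nat n + 2 * (1 / 2))"
    by (simp add: add.commute)
  also note *(2)
  also have "(-1) ^ n * 2 powi (- int n) * of_real pi powr (2 * (of_nat n + 1 / 2)) /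
      (Gamma (1 - 1 / 2) * Gamma (of_nat n + 1 / 2)) * (LINT s:{0<..}|lborel. complex_of_real (R s)) =
     of_real ((-1) ^ n * pi ^ (2 * n + 1) / (2 ^ n * (Gamma (1 / 2) * Gamma (real n + 1 / 2))) *
             (LINT s:{0<..}|lborel. R s))"
    unfolding int pow half gam by (simp add: power_int_minus field_simps)
  finally show "zeta (of_nat (2 * n + 1)) =
           of_real ((-1) ^ n * pi ^ (2 * n + 1) / (2 ^ n * (Gamma (1 / 2) * Gamma (real n + 1 / 2))) *
             (LINT s:{0<..}|lborel. R s))" .
qed

text \<open>
  With \<open>coth\<close> and \<open>sinh powi (-2)\<close> as the basic functions, the class of polynomials in
  these two functions, \<open>s\<close> and \<open>1 / s\<close> is closed under differentiation, and the iterates below stay in the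
  form in which the formulas for \<open>zeta 5\<close> and \<open>zeta 7\<close> state them.
\<close>

lemma has_field_derivative_coth [derivative_intros]:
  assumes "(f has_field_derivative D) (at x within A)" "f x \<noteq> 0"
  shows "((\<lambda>x. coth (f x)) has_field_derivative (- (sinh (f x) powi (-2)) * D)) (at x within A)"
proof -
  have "(coth has_field_derivative (- (sinh (f x) powi (-2)))) (at (f x))"
    unfolding coth_def [abs_def] using assms(2) hyperbolic_pythagoras[of "f x"]
    by (auto intro!: derivative_eq_intros simp: power_int_minus power2_eq_square field_simps)
  thus ?thesis using assms(1) by (rule DERIV_chain2)
qed

lemma has_field_derivative_sinh_power_minus_2 [derivative_intros]:
  fixes f :: "real \<Rightarrow> real"
  assumes "(f has_field_derivative D) (at x within A)" "f x \<noteq> 0"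
  shows "((\<lambda>x. sinh (f x) powi (-2)) has_field_derivative (- 2 * coth (f x) * sinh (f x) powi (-2) * D)) (at x within A)"
proof -
  have "((\<lambda>x. sinh x powi (-2)) has_field_derivative (- 2 * coth (f x) * sinh (f x) powi (-2))) (at (f x))"
    using assms(2) unfolding power_int_minus
    by (auto intro!: derivative_eq_intros simp: coth_def power_int_minus power2_eq_square field_simps)
  thus ?thesis using assms(1) by (rule DERIV_chain2)
qed

lemma radial_deriv_coth_1:
  assumes s: "s > 0"
  shows "(radial_deriv ^^ 1) (\<lambda>x. x powi (-2) * (x * coth x - 1)) s =
           s powi (-4) * (2 - s * coth s - s\<^sup>2 * sinh s powi (-2))"
proof -
  have "radial_deriv (\<lambda>x. x powi (-2) * (x * coth x - 1)) s =
           s powi (-4) * (2 - s * coth s - s\<^sup>2 * sinh s powi (-2))"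
  proof (rule radial_deriv_eqI[OF _ _ s])
    show "((\<lambda>x. (x * coth x - 1) / x\<^sup>2) has_field_derivative
            s * (s powi (-4) * (2 - s * coth s - s\<^sup>2 * sinh s powi (-2)))) (at s)"
      by (rule derivative_eq_intros refl | use s in \<open>simp; fail\<close>)+
         (use s in \<open>simp add: power_int_minus field_simps eval_nat_numeral\<close>)
  qed (simp add: power_int_minus field_simps)
  thus ?thesis by simp
qed

lemma radial_deriv_coth_2:
  assumes s: "s > 0"
  shows "(radial_deriv ^^ 2) (\<lambda>x. x powi (-2) * (x * coth x - 1)) s =
           s powi (-6) * (2 * s ^ 3 * coth s * sinh s powi (-2) + 3 * s ^ 2 * sinh s powi (-2)
                  + 3 * s * coth s - 8)" (is "_ = ?H s")
proof -
  have "radial_deriv ((radial_deriv ^^ 1) (\<lambda>x. x powi (-2) * (x * coth x - 1))) s = ?H s"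
  proof (rule radial_deriv_eqI[OF radial_deriv_coth_1 _ s])
    show "((\<lambda>s. s powi (-4) * (2 - s * coth s - s\<^sup>2 * sinh s powi (-2))) has_field_derivative s * ?H s) (at s)"
      by (rule derivative_eq_intros refl | use s in \<open>simp; fail\<close>)+
         (use s in \<open>simp add: power_int_minus power_int_diff field_simps eval_nat_numeral\<close>)
  qed
  thus ?thesis by (simp add: numeral_2_eq_2)
qed

lemma radial_deriv_coth_3:
  assumes s: "s > 0"
  shows "(radial_deriv ^^ 3) (\<lambda>x. x powi (-2) * (x * coth x - 1)) s =
           - (s powi (-8) *
                (4 * s ^ 4 * coth s ^ 2 * sinh s powi (-2) + 2 * s ^ 4 * sinh s powi (-4)
                  + 12 * s ^ 3 * coth s * sinh s powi (-2) + 15 * s ^ 2 * sinh s powi (-2)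
                  + 15 * s * coth s - 48))" (is "_ = ?K s")
proof -
  have "radial_deriv ((radial_deriv ^^ 2) (\<lambda>x. x powi (-2) * (x * coth x - 1))) s = ?K s"
  proof (rule radial_deriv_eqI[OF radial_deriv_coth_2 _ s])
    have eq4: "sinh s powi (-4) = sinh s powi (-2) * sinh s powi (-2)"
      using s by (subst power_int_add [symmetric]) auto
    show "((\<lambda>s. s powi (-6) * (2 * s ^ 3 * coth s * sinh s powi (-2) + 3 * s ^ 2 * sinh s powi (-2)
                  + 3 * s * coth s - 8)) has_field_derivative s * ?K s) (at s)"
      unfolding eq4
      by (rule derivative_eq_intros refl | use s in \<open>simp; fail\<close>)+
         (use s in \<open>simp add: power_int_minus power_int_diff field_simps eval_nat_numeral\<close>)
  qed
  thus ?thesis by (simp add: numeral_3_eq_3 numeral_2_eq_2)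
qed

lemma Gamma_half_products:
  "Gamma (1 / 2) * Gamma (5 / 2) = 3 / 4 * pi"
  "Gamma (1 / 2) * Gamma (7 / 2) = 15 / 8 * pi"
proof -
  have "x \<notin> \<int>\<^sub>\<le>\<^sub>0" if "x > 0" for x :: real
    using that by (auto elim!: nonpos_Ints_cases)
  hence "Gamma (3 / 2 :: real) = 1 / 2 * Gamma (1 / 2)" "Gamma (5 / 2 :: real) = 3 / 2 * Gamma (3 / 2)"
       "Gamma (7 / 2 :: real) = 5 / 2 * Gamma (5 / 2)"
    using Gamma_plus1[of "1/2 :: real"] Gamma_plus1[of "3/2 :: real"] Gamma_plus1[of "5/2 :: real"]
    by simp_all
  hence "Gamma (1 / 2) * Gamma (5 / 2 :: real) = 3 / 4 * (Gamma (1 / 2) * Gamma (1 / 2))"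
        "Gamma (1 / 2) * Gamma (7 / 2 :: real) = 15 / 8 * (Gamma (1 / 2) * Gamma (1 / 2))"
    by simp_all
  moreover have "Gamma (1 / 2) * Gamma (1 / 2) = pi"
    by (simp add: Gamma_one_half_real)
  ultimately show "Gamma (1 / 2) * Gamma (5 / 2) = 3 / 4 * pi"
      "Gamma (1 / 2) * Gamma (7 / 2) = 15 / 8 * pi" by simp_all
qed

theorem theorem2p8:
  shows
    "(\<forall>(n::nat) (z::complex).
        0 < Re z \<and> Re z < 1 \<and> Re (2 * of_nat n + 2 * z) > 1 \<longrightarrow>
          (let F = (\<lambda>t::real. of_real t powr (- z) *
                     of_real ((deriv ^^ n) (\<lambda>x. inverse (2 * x) * (sqrt x * coth (sqrt x) - 1)) t));
               G = (\<lambda>s::real. of_real s powr (1 - 2 * z) *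
                     of_real ((radial_deriv ^^ n) (\<lambda>x. x powi (-2) * (x * coth x - 1)) s))
           in
             set_integrable lborel {0<..} F \<and>
             zeta (2 * of_nat n + 2 * z) =
               (-1) ^ n * of_real pi powr (2 * (of_nat n + z)) /
                 (Gamma (1 - z) * Gamma (of_nat n + z)) * (LINT t:{0<..}|lborel. F t) \<and>
             set_integrable lborel {0<..} G \<and>
             zeta (2 * of_nat n + 2 * z) =
               (-1) ^ n * 2 powi (- int n) * of_real pi powr (2 * (of_nat n + z)) /
                 (Gamma (1 - z) * Gamma (of_nat n + z)) * (LINT s:{0<..}|lborel. G s))) \<and>
     (let H = (\<lambda>s::real. s powi (-6) *
                (2 * s ^ 3 * coth s * sinh s powi (-2) + 3 * s ^ 2 * sinh s powi (-2)
                  + 3 * s * coth s - 8))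
      in set_integrable lborel {0<..} H \<and>
         zeta 5 = of_real (pi ^ 4 / 3 * (LINT s:{0<..}|lborel. H s))) \<and>
     (let K = (\<lambda>s::real. s powi (-8) *
                (4 * s ^ 4 * coth s ^ 2 * sinh s powi (-2) + 2 * s ^ 4 * sinh s powi (-4)
                  + 12 * s ^ 3 * coth s * sinh s powi (-2) + 15 * s ^ 2 * sinh s powi (-2)
                  + 15 * s * coth s - 48))
      in set_integrable lborel {0<..} K \<and>
         zeta 7 = of_real (pi ^ 6 / 15 * (LINT s:{0<..}|lborel. K s)))"
proof (intro conjI allI impI)
  fix n :: nat and z :: complex
  assume "0 < Re z \<and> Re z < 1 \<and> 1 < Re (2 * of_nat n + 2 * z)"
  hence z: "0 < Re z" "Re z < 1" "1 < Re (2 * of_nat n + 2 * z)" by auto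
  show "let F = (\<lambda>t::real. of_real t powr (- z) *
                     of_real ((deriv ^^ n) (\<lambda>x. inverse (2 * x) * (sqrt x * coth (sqrt x) - 1)) t));
               G = (\<lambda>s::real. of_real s powr (1 - 2 * z) *
                     of_real ((radial_deriv ^^ n) (\<lambda>x. x powi (-2) * (x * coth x - 1)) s))
           in
             set_integrable lborel {0<..} F \<and>
             zeta (2 * of_nat n + 2 * z) =
               (-1) ^ n * of_real pi powr (2 * (of_nat n + z)) /
                 (Gamma (1 - z) * Gamma (of_nat n + z)) * (LINT t:{0<..}|lborel. F t) \<and>
             set_integrable lborel {0<..} G \<and>
             zeta (2 * of_nat n + 2 * z) =
               (-1) ^ n * 2 powi (- int n) * of_real pi powr (2 * (of_nat n + z)) /
                 (Gamma (1 - z) * Gamma (of_nat n + z)) * (LINT s:{0<..}|lborel. G s)"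
    unfolding Let_def
    by (intro conjI set_integral_Ioi_pole_sum_deriv[OF z] set_integral_Ioi_pole_sum_deriv_square[OF z])
       (simp_all only: funpow_deriv_eq_pole_sum_deriv funpow_radial_deriv_eq_pole_sum_deriv)
next
  let ?H = "\<lambda>s::real. s powi (-6) *
                (2 * s ^ 3 * coth s * sinh s powi (-2) + 3 * s ^ 2 * sinh s powi (-2)
                  + 3 * s * coth s - 8)"
  note * = zeta_odd_integral[where n = 2 and R = ?H, OF _ radial_deriv_coth_2 [symmetric]]
  have "zeta 5 = of_real (pi ^ 4 / 3 * (LINT s:{0<..}|lborel. ?H s))"
    using *(2) Gamma_half_products(1) by (simp add: eval_nat_numeral)
  thus "let H = ?H in set_integrable lborel {0<..} H \<and> zeta 5 = of_real (pi ^ 4 / 3 * (LINT s:{0<..}|lborel. H s))"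
    using *(1) by (simp add: Let_def)
next
  let ?K = "\<lambda>s::real. s powi (-8) *
                (4 * s ^ 4 * coth s ^ 2 * sinh s powi (-2) + 2 * s ^ 4 * sinh s powi (-4)
                  + 12 * s ^ 3 * coth s * sinh s powi (-2) + 15 * s ^ 2 * sinh s powi (-2)
                  + 15 * s * coth s - 48)"
  \<comment> \<open>The third iterate is \<open>- K\<close>; this sign cancels the factor \<open>(-1) ^ 3\<close>.\<close>
  note * = zeta_odd_integral[where n = 3 and R = "\<lambda>s. - ?K s", OF _ radial_deriv_coth_3 [symmetric]]
  have "set_integrable lborel {0<..} (\<lambda>s. - (- ?K s))"
    using *(1) by (simp add: set_integrable_def)
  hence "set_integrable lborel {0<..} ?K"
    by (simp only: minus_minus)
  moreover from this have "(LINT s:{0<..}|lborel. - ?K s) = - (LINT s:{0<..}|lborel. ?K s)"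
    by (rule set_integral_uminus)
  hence "zeta 7 = of_real (pi ^ 6 / 15 * (LINT s:{0<..}|lborel. ?K s))"
    using *(2) Gamma_half_products(2) by (simp add: eval_nat_numeral)
  ultimately show "let K = ?K in set_integrable lborel {0<..} K \<and> zeta 7 = of_real (pi ^ 6 / 15 * (LINT s:{0<..}|lborel. K s))"
    by (simp only: Let_def conj_absorb simp_thms)
qed

end
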